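(* Let $\{p_k\}_{k\ge 0}$ be the antisymmetric orthogonal polynomials on the Sierpinski gasket $SG$ obtained from $\{P_{k3}\}_{k\ge 0}$ by the (unnormalized, monic) Gram–Schmidt process, so $p_0=P_{03}$, and put $p_{-1}:=0$ and $d_k^{-2}:=\|p_k\|_{L^2}^2$. Let $f_0:=0$ and for $k\ge 0$ let $f_{k+1}$ be the polynomial defined by $$f_{k+1}(x):=-\int_{SG} G(x,y)\,p_k(y)\,d\mu(y).$$ Then for each $k\ge 0$ $$p_{k+1}(x)=f_{k+1}(x)-b_k\,p_k(x)-c_k\,p_{k-1}(x)\qquad (x\in SG),$$ where $b_k=d_k^2\langle f_{k+1},p_k\rangle$ for $k\ge 0$ and $c_k=\dfrac{d_{k-1}^2}{d_k^2}=\dfrac{\|p_k\|_{L^2}^2}{\|p_{k-1}\|_{L^2}^2}$ for $k\ge 1$ (for $k=0$ the term $c_0p_{-1}$ is $0$). Consequently, for $k\ge 1$, $$d_k^{-2}=\|p_k\|_{L^2}^2=d_0^{-2}\,c_1c_2\cdots c_k.$$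
   Context: Sierpinski gasket: let $q_0,q_1,q_2$ be the vertices of an equilateral triangle in $\mathbb{R}^2$, $F_i(x)=\tfrac12(x-q_i)+q_i$, and $SG$ the nonempty compact set with $SG=\bigcup_{i=0}^2F_i(SG)$. For a word $w=(w_1,\dots,w_m)$, $F_w=F_{w_1}\circ\cdots\circ F_{w_m}$ and $F_w(SG)$ is a cell of level $m$. $V_0=\{q_0,q_1,q_2\}$ is the boundary, $V_m=\bigcup_iF_iV_{m-1}$, $V_*=\bigcup_mV_m$; for distinct $x,y\in V_m$, $x\sim_m y$ iff $x,y$ lie in a common cell of level $m$. $\mu$ is the probability measure on $SG$ giving mass $3^{-m}$ to each cell of level $m$; all functions are real-valued, $\langle f,g\rangle=\int_{SG}fg\,d\mu$ and $\|f\|_{L^2}^2=\langle f,f\rangle$. Laplacian: $\Delta u(x)=\lim_{m\to\infty}\tfrac32 5^m\sum_{y\sim_m x}(u(y)-u(x))$ for $x\in V_*\setminus V_0$; a continuous $u$ is in the domain with $\Delta u=f$ ($f$ continuous on $SG$) if these limits converge uniformly to $f$ on $V_*\setminus V_0$. Derivatives at $q_0$: $\partial_nu(q_0)=\lim_m(5/3)^m\big(2u(q_0)-u(F_0^mq_1)-u(F_0^mq_2)\big)$ and $\partial_Tu(q_0)=\lim_m5^m\big(u(F_0^mq_1)-u(F_0^mq_2)\big)$. Green's function: $G(x,y)$ is the continuous symmetric kernel on $SG\times SG$ such that for every continuous $f$ the unique solution of $-\Delta u=f$, $u|_{V_0}=0$ is $u(x)=\int_{SG}G(x,y)f(y)\,d\mu(y)$.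 Polynomials: a polynomial of degree at most $j$ is a function $u$ with $\Delta^{j+1}u=0$. The antisymmetric monomial $P_{j3}$ ($j\ge0$) is the unique function with $\Delta^{j+1}P_{j3}=0$ and, for $0\le m\le j$, $\Delta^mP_{j3}(q_0)=0$, $\partial_n\Delta^mP_{j3}(q_0)=0$, $\partial_T\Delta^mP_{j3}(q_0)=\delta_{m,j}$. Gram–Schmidt: $p_0=P_{03}$ and $p_j=P_{j3}-\sum_{l=0}^{j-1}d_l^2\langle P_{j3},p_l\rangle p_l$ for $j\ge1$, where $d_l>0$ and $d_l^{-2}=\|p_l\|_{L^2}^2$. *)

theory Defs
  imports "HOL-Analysis.Analysis" "HOL-Probability.Probability"
begin

type_synonym plane = "real^2"

definition equilateral :: "(nat \<Rightarrow> plane) \<Rightarrow> bool" where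
  "equilateral q \<longleftrightarrow> q 0 \<noteq> q 1 \<and>
     dist (q 0) (q 1) = dist (q 1) (q 2) \<and> dist (q 0) (q 1) = dist (q 0) (q 2)"

definition sg_map :: "(nat \<Rightarrow> plane) \<Rightarrow> nat \<Rightarrow> plane \<Rightarrow> plane" where
  "sg_map q i x = (1/2) *\<^sub>R (x - q i) + q i"

text \<open>The gasket is the attractor of the three contractions; it exists and is unique by
  Hutchinson's theorem.\<close>

definition SG :: "(nat \<Rightarrow> plane) \<Rightarrow> plane set" where
  "SG q = (THE K. compact K \<and> K \<noteq> {} \<and> K = (\<Union>i<3. sg_map q i ` K))"

fun word_map :: "(nat \<Rightarrow> plane) \<Rightarrow> nat list \<Rightarrow> plane \<Rightarrow> plane" where
  "word_map q [] = id"
| "word_map q (i # w) = sg_map q i \<circ> word_map q w"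

definition words :: "nat \<Rightarrow> nat list set" where
  "words m = {w. length w = m \<and> set w \<subseteq> {..<3}}"

definition cell :: "(nat \<Rightarrow> plane) \<Rightarrow> nat list \<Rightarrow> plane set" where
  "cell q w = word_map q w ` SG q"

fun V :: "(nat \<Rightarrow> plane) \<Rightarrow> nat \<Rightarrow> plane set" where
  "V q 0 = q ` {..<3}"
| "V q (Suc m) = (\<Union>i<3. sg_map q i ` V q m)"

definition adjacent :: "(nat \<Rightarrow> plane) \<Rightarrow> nat \<Rightarrow> plane \<Rightarrow> plane \<Rightarrow> bool" where
  "adjacent q m x y \<longleftrightarrow> x \<in> V q m \<and> y \<in> V q m \<and> x \<noteq> y \<and>
     (\<exists>w\<in>words m. x \<in> cell q w \<and> y \<in> cell q w)"

definition sg_measure :: "(nat \<Rightarrow> plane) \<Rightarrow> plane measure \<Rightarrow> bool" where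
  "sg_measure q \<mu> \<longleftrightarrow> prob_space \<mu> \<and> sets \<mu> = sets (restrict_space borel (SG q)) \<and>
     (\<forall>m. \<forall>w\<in>words m. measure \<mu> (cell q w) = (1/3) ^ m)"

definition l2_inner :: "plane measure \<Rightarrow> (plane \<Rightarrow> real) \<Rightarrow> (plane \<Rightarrow> real) \<Rightarrow> real" where
  "l2_inner \<mu> f g = (LINT x|\<mu>. f x * g x)"

definition l2_norm :: "plane measure \<Rightarrow> (plane \<Rightarrow> real) \<Rightarrow> real" where
  "l2_norm \<mu> f = sqrt (l2_inner \<mu> f f)"

text \<open>Functions on the gasket are functions on the plane of which only the values on
  \<^term>\<open>SG q\<close> matter.  Accordingly the Laplacian is a relation:
  \<open>has_laplacian q u f\<close> says that \<open>u\<close> is in the domain of the Laplacian and \<open>\<Delta>u = f\<close>.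
  At a point of \<open>V\<^sub>*\<close>, the discrete Laplacian of level \<open>m\<close> is meaningful only
  once the point belongs to \<open>V\<^sub>m\<close>; uniform convergence on \<open>V\<^sub>* - V\<^sub>0\<close>
  therefore means that the error on \<open>V\<^sub>m - V\<^sub>0\<close> tends to \<open>0\<close> uniformly.\<close>

definition laplacian_level ::
    "(nat \<Rightarrow> plane) \<Rightarrow> nat \<Rightarrow> (plane \<Rightarrow> real) \<Rightarrow> plane \<Rightarrow> real" where
  "laplacian_level q m u x = 3/2 * 5 ^ m * (\<Sum>y\<in>{y. adjacent q m x y}. u y - u x)"

definition has_laplacian ::
    "(nat \<Rightarrow> plane) \<Rightarrow> (plane \<Rightarrow> real) \<Rightarrow> (plane \<Rightarrow> real) \<Rightarrow> bool" where
  "has_laplacian q u f \<longleftrightarrow> continuous_on (SG q) u \<and> continuous_on (SG q) f \<and>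
     (\<forall>\<epsilon>>0. \<exists>N. \<forall>m\<ge>N. \<forall>x\<in>V q m - V q 0. \<bar>laplacian_level q m u x - f x\<bar> < \<epsilon>)"

fun has_laplacian_pow ::
    "(nat \<Rightarrow> plane) \<Rightarrow> nat \<Rightarrow> (plane \<Rightarrow> real) \<Rightarrow> (plane \<Rightarrow> real) \<Rightarrow> bool" where
  "has_laplacian_pow q 0 u f \<longleftrightarrow> (\<forall>x\<in>SG q. u x = f x)"
| "has_laplacian_pow q (Suc n) u f \<longleftrightarrow>
     (\<exists>v. has_laplacian q u v \<and> has_laplacian_pow q n v f)"

definition has_normal_deriv :: "(nat \<Rightarrow> plane) \<Rightarrow> (plane \<Rightarrow> real) \<Rightarrow> real \<Rightarrow> bool" where
  "has_normal_deriv q u a \<longleftrightarrow>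
     (\<lambda>m. (5/3) ^ m * (2 * u (q 0) - u ((sg_map q 0 ^^ m) (q 1)) - u ((sg_map q 0 ^^ m) (q 2))))
       \<longlonglongrightarrow> a"

definition has_tangential_deriv :: "(nat \<Rightarrow> plane) \<Rightarrow> (plane \<Rightarrow> real) \<Rightarrow> real \<Rightarrow> bool" where
  "has_tangential_deriv q u a \<longleftrightarrow>
     (\<lambda>m. 5 ^ m * (u ((sg_map q 0 ^^ m) (q 1)) - u ((sg_map q 0 ^^ m) (q 2)))) \<longlonglongrightarrow> a"

definition solves_dirichlet ::
    "(nat \<Rightarrow> plane) \<Rightarrow> (plane \<Rightarrow> real) \<Rightarrow> (plane \<Rightarrow> real) \<Rightarrow> bool" where
  "solves_dirichlet q f u \<longleftrightarrow> has_laplacian q u (\<lambda>x. - f x) \<and> (\<forall>x\<in>V q 0. u x = 0)"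

definition is_green_function ::
    "(nat \<Rightarrow> plane) \<Rightarrow> plane measure \<Rightarrow> (plane \<Rightarrow> plane \<Rightarrow> real) \<Rightarrow> bool" where
  "is_green_function q \<mu> G \<longleftrightarrow>
     continuous_on (SG q \<times> SG q) (\<lambda>(x, y). G x y) \<and>
     (\<forall>x\<in>SG q. \<forall>y\<in>SG q. G x y = G y x) \<and>
     (\<forall>f. continuous_on (SG q) f \<longrightarrow>
        solves_dirichlet q f (\<lambda>x. LINT y|\<mu>. G x y * f y) \<and>
        (\<forall>u. solves_dirichlet q f u \<longrightarrow> (\<forall>x\<in>SG q. u x = (LINT y|\<mu>. G x y * f y))))"

definition sg_polynomial :: "(nat \<Rightarrow> plane) \<Rightarrow> nat \<Rightarrow> (plane \<Rightarrow> real) \<Rightarrow> bool" where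
  "sg_polynomial q j u \<longleftrightarrow> has_laplacian_pow q (Suc j) u (\<lambda>x. 0)"

definition antisym_monomial_conds ::
    "(nat \<Rightarrow> plane) \<Rightarrow> nat \<Rightarrow> (plane \<Rightarrow> real) \<Rightarrow> bool" where
  "antisym_monomial_conds q j u \<longleftrightarrow> sg_polynomial q j u \<and>
     (\<forall>m\<le>j. \<exists>v. has_laplacian_pow q m u v \<and> v (q 0) = 0 \<and> has_normal_deriv q v 0 \<and>
        has_tangential_deriv q v (if m = j then 1 else 0))"

definition is_antisym_monomial ::
    "(nat \<Rightarrow> plane) \<Rightarrow> nat \<Rightarrow> (plane \<Rightarrow> real) \<Rightarrow> bool" where
  "is_antisym_monomial q j u \<longleftrightarrow> antisym_monomial_conds q j u \<and>
     (\<forall>v. antisym_monomial_conds q j v \<longrightarrow> (\<forall>x\<in>SG q. v x = u x))"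

end

theory Submission
  imports Defs
begin

text \<open>
  Let \<open>f\<^bsub>k+1\<^esub>\<close> be the solution of \<open>\<Delta>f\<^bsub>k+1\<^esub> = p\<^sub>k\<close> vanishing on the boundary. By uniqueness of the
  monomials and of the Dirichlet problem, the reflection that exchanges \<open>q\<^sub>1\<close> and \<open>q\<^sub>2\<close> changes the
  sign of every \<open>P\<^bsub>j3\<^esub>\<close>, \<open>p\<^sub>j\<close> and \<open>f\<^sub>j\<close>. Antisymmetric harmonic functions are multiples of
  \<open>P\<^sub>0\<^sub>3\<close>, and \<open>\<Delta>P\<^bsub>j+1,3\<^esub> = P\<^bsub>j3\<^esub>\<close>, so \<open>f\<^bsub>k+1\<^esub> - p\<^bsub>k+1\<^esub>\<close> lies in the span of \<open>p\<^sub>0, \<dots>, p\<^sub>k\<close>.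
  Since Green's operator is self-adjoint, its coefficient at \<open>p\<^sub>l\<close> is
  \<open>d\<^sub>l\<^sup>2\<langle>p\<^sub>k, f\<^bsub>l+1\<^esub>\<rangle>\<close>, which is zero for \<open>l < k - 1\<close> and \<open>d\<^bsub>k-1\<^esub>\<^sup>2/d\<^sub>k\<^sup>2\<close> for
  \<open>l = k - 1\<close>. The norms are positive because cells have positive measure and \<open>\<Delta>\<^sup>k p\<^sub>k = P\<^sub>0\<^sub>3\<close>
  is nonzero.
\<close>

section \<open>The gasket as an attractor\<close>

lemma ex_divide_two_power_less:
  fixes D e :: real
  assumes "e > 0"
  shows "\<exists>n. D / 2 ^ n < e"
proof -
  obtain n where "D / e < 2 ^ n"
    using real_arch_pow[of 2 "D / e"] by auto
  then show ?thesis
    using assms by (auto simp: field_simps)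
qed

lemma sg_map_midpoint: "sg_map q i x = (1/2) *\<^sub>R x + (1/2) *\<^sub>R q i"
  unfolding sg_map_def scaleR_diff_right
  using scaleR_half_double[of "q i"] by (simp add: scaleR_add_right algebra_simps)

lemma sg_map_vertex [simp]: "sg_map q i (q i) = q i"
  by (simp add: sg_map_def)

lemma dist_sg_map: "dist (sg_map q i x) (sg_map q i y) = dist x y / 2"
proof -
  have "sg_map q i x - sg_map q i y = (1/2) *\<^sub>R (x - y)"
    unfolding sg_map_def scaleR_diff_right by simp
  then show ?thesis
    by (simp add: dist_norm)
qed

lemma dist_sg_map_funpow_vertex: "dist ((sg_map q i ^^ n) x) (q i) = dist x (q i) / 2 ^ n"
proof (induction n)
  case (Suc n)
  then show ?case
    using dist_sg_map[of q i "(sg_map q i ^^ n) x" "q i"] by simp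
qed simp

lemma sg_map_funpow_tendsto_vertex: "(\<lambda>n. (sg_map q i ^^ n) x) \<longlonglongrightarrow> q i"
proof -
  have "(\<lambda>n. dist x (q i) * (1/2) ^ n) \<longlonglongrightarrow> dist x (q i) * 0"
    by (intro tendsto_intros LIMSEQ_power_zero) auto
  then have "(\<lambda>n. dist ((sg_map q i ^^ n) x) (q i)) \<longlonglongrightarrow> 0"
    by (simp add: dist_sg_map_funpow_vertex power_divide)
  then show ?thesis
    by (rule tendsto_dist_iff[THEN iffD2])
qed

lemma continuous_on_sg_map: "continuous_on S (sg_map q i)"
  unfolding sg_map_def by (intro continuous_intros)

lemma vertex_in_V: "i < 3 \<Longrightarrow> q i \<in> V q m"
proof (induction m)
  case (Suc m)
  then show ?case
    using imageI[of "q i" "V q m" "sg_map q i"] by (auto simp del: lessThan_Suc)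
qed auto

lemma V_subset_Suc: "V q m \<subseteq> V q (Suc m)"
proof (induction m)
  case 0
  show ?case
    using vertex_in_V[where m = "Suc 0"] by auto
next
  case (Suc m)
  have "(\<Union>i<3. sg_map q i ` V q m) \<subseteq> (\<Union>i<3. sg_map q i ` V q (Suc m))"
    by (intro UN_mono image_mono order_refl Suc.IH)
  then show ?case
    by (simp only: V.simps)
qed

lemma V_mono: "m \<le> n \<Longrightarrow> V q m \<subseteq> V q n"
  by (rule lift_Suc_mono_le[of "V q"]) (rule V_subset_Suc)

text \<open>The nesting of the vertex sets gives the reverse inclusion: a point of
  \<open>V q m\<close> also lies in \<open>V q (Suc m)\<close>, so it is an image under one of the
  three maps.\<close>

lemma image_sg_map_V_star: "(\<Union>i<3. sg_map q i ` (\<Union>m. V q m)) = (\<Union>m. V q m)"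
proof
  show "(\<Union>i<3. sg_map q i ` (\<Union>m. V q m)) \<subseteq> (\<Union>m. V q m)"
  proof
    fix y assume "y \<in> (\<Union>i<3. sg_map q i ` (\<Union>m. V q m))"
    then obtain i m where "i < 3" "y \<in> sg_map q i ` V q m"
      by blast
    then have "y \<in> V q (Suc m)"
      by auto
    then show "y \<in> (\<Union>m. V q m)"
      by blast
  qed
  show "(\<Union>m. V q m) \<subseteq> (\<Union>i<3. sg_map q i ` (\<Union>m. V q m))"
  proof
    fix x assume "x \<in> (\<Union>m. V q m)"
    then obtain m where "x \<in> V q (Suc m)"
      using V_subset_Suc by blast
    then show "x \<in> (\<Union>i<3. sg_map q i ` (\<Union>m. V q m))"
      by auto
  qed
qed

text \<open>An invariant compact set contains the fixed point of each map as a limit of iterates,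
  hence every \<open>V q m\<close>. Conversely, each application of a map halves distances, so
  points of \<open>K\<close> are within \<open>D / 2 ^ n\<close> of \<open>V q n\<close>.\<close>

lemma sg_attractor_unique:
  assumes "compact K" "K \<noteq> {}" and inv: "K = (\<Union>i<3. sg_map q i ` K)"
  shows "K = closure (\<Union>m. V q m)"
proof
  have step: "sg_map q i x \<in> K" if "x \<in> K" "i < 3" for i x
    using inv that by blast
  have vertex: "q i \<in> K" if "i < 3" for i
  proof -
    obtain x where "x \<in> K"
      using \<open>K \<noteq> {}\<close> by blast
    then have "(sg_map q i ^^ n) x \<in> K" for n
      by (induction n) (use step that in auto)
    then show ?thesis
      by (rule closed_sequentially[OF compact_imp_closed[OF \<open>compact K\<close>] _ sg_map_funpow_tendsto_vertex])
  qed
  have "V q m \<subseteq> K" for m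
    by (induction m) (use vertex step in auto)
  then show "closure (\<Union>m. V q m) \<subseteq> K"
    using \<open>compact K\<close> by (intro closure_minimal compact_imp_closed) auto
  obtain D where D: "dist x (q 0) \<le> D" if "x \<in> K" for x
    using compact_imp_bounded[OF \<open>compact K\<close>] bounded_any_center[of K "q 0"]
    by (auto simp: dist_commute)
  have approx: "\<forall>x\<in>K. \<exists>v\<in>V q n. dist x v \<le> D / 2 ^ n" for n
  proof (induction n)
    case 0
    show ?case
      using D by (auto intro!: bexI[of _ "0::nat"])
  next
    case (Suc n)
    show ?case
    proof
      fix x assume "x \<in> K"
      then obtain i y where y: "i < 3" "y \<in> K" "x = sg_map q i y"
        using inv by blast
      then obtain v where "v \<in> V q n" "dist y v \<le> D / 2 ^ n"
        using Suc by blast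
      then show "\<exists>v\<in>V q (Suc n). dist x v \<le> D / 2 ^ Suc n"
        using y by (intro bexI[of _ "sg_map q i v"]) (auto simp: dist_sg_map)
    qed
  qed
  show "K \<subseteq> closure (\<Union>m. V q m)"
  proof
    fix x assume "x \<in> K"
    show "x \<in> closure (\<Union>m. V q m)"
      unfolding closure_approachable
    proof (intro allI impI)
      fix e :: real assume "e > 0"
      then obtain n where n: "D / 2 ^ n < e"
        using ex_divide_two_power_less by blast
      obtain v where "v \<in> V q n" "dist x v \<le> D / 2 ^ n"
        using approx \<open>x \<in> K\<close> by blast
      then show "\<exists>v\<in>(\<Union>m. V q m). dist v x < e"
        using n by (intro bexI[of _ v]) (auto simp: dist_commute)
    qed
  qed
qed

lemma bounded_V_star: "bounded (\<Union>m. V q m)"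
proof -
  define B where "B = Max (norm ` q ` {..<3})"
  have B: "norm (q i) \<le> B" if "i < 3" for i
    unfolding B_def using that by (intro Max_ge) auto
  \<comment> \<open>A ball is convex, so midpoints with the vertices stay inside it.\<close>
  have "norm (sg_map q i x) \<le> B" if "norm x \<le> B" "i < 3" for i x
    using norm_triangle_ineq[of "(1/2) *\<^sub>R x" "(1/2) *\<^sub>R q i"] B[OF that(2)] that(1)
    by (simp add: sg_map_midpoint)
  then have "\<forall>x\<in>V q m. norm x \<le> B" for m
    by (induction m) (use B in auto)
  then show ?thesis
    unfolding bounded_iff by blast
qed

text \<open>Existence comes from the concrete candidate: the union of the vertex sets is bounded and
  invariant, and invariance passes to the closure because the three images of a compact set have a
  closed union.\<close>

lemma sg_attractor_closure_V_star:
  defines "K \<equiv> \<lambda>q. closure (\<Union>m. V q m)"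
  shows "compact (K q)" "K q \<noteq> {}" "K q = (\<Union>i<3. sg_map q i ` K q)"
proof -
  define S where "S = (\<Union>m. V q m)"
  have K: "K q = closure S"
    by (simp add: K_def S_def)
  have S: "S = (\<Union>i<3. sg_map q i ` S)"
    unfolding S_def by (simp only: image_sg_map_V_star)
  show compact: "compact (K q)"
    using bounded_V_star[of q] by (simp add: K S_def compact_closure)
  show "K q \<noteq> {}"
    using vertex_in_V[of 0 q] by (auto simp: K S_def)
  show "K q = (\<Union>i<3. sg_map q i ` K q)"
  proof
    have "closed (\<Union>i<3. sg_map q i ` K q)"
      by (intro closed_UN finite_lessThan ballI compact_imp_closed compact_continuous_image
          continuous_on_sg_map compact)
    moreover have "S \<subseteq> (\<Union>i<3. sg_map q i ` K q)"
      unfolding K by (subst S) (intro UN_mono image_mono closure_subset order_refl)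
    ultimately show "K q \<subseteq> (\<Union>i<3. sg_map q i ` K q)"
      unfolding K by (intro closure_minimal)
    have "sg_map q i ` K q \<subseteq> K q" if "i < 3" for i
    proof -
      have "sg_map q i ` S \<subseteq> S"
        by (subst (2) S) (use that in blast)
      then show ?thesis
        unfolding K using closure_subset
        by (intro image_closure_subset continuous_on_sg_map closed_closure) (rule order_trans)
    qed
    then show "(\<Union>i<3. sg_map q i ` K q) \<subseteq> K q"
      by (intro UN_least) simp
  qed
qed

text \<open>Existence and uniqueness together resolve the definite description in
  \<open>SG\<close>.\<close>

lemma SG_eq: "SG q = closure (\<Union>m. V q m)"
  unfolding SG_def
proof (rule the_equality)
  show "compact (closure (\<Union>m. V q m)) \<and> closure (\<Union>m. V q m) \<noteq> {} \<and>
      closure (\<Union>m. V q m) = (\<Union>i<3. sg_map q i ` closure (\<Union>m. V q m))"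
    by (intro conjI sg_attractor_closure_V_star)
qed (elim conjE, rule sg_attractor_unique)

lemma compact_SG: "compact (SG q)"
  unfolding SG_eq by (rule sg_attractor_closure_V_star)

lemma SG_invariant: "SG q = (\<Union>i<3. sg_map q i ` SG q)"
  unfolding SG_eq by (rule sg_attractor_closure_V_star)

lemma sg_map_in_SG: "x \<in> SG q \<Longrightarrow> i < 3 \<Longrightarrow> sg_map q i x \<in> SG q"
  by (subst SG_invariant) blast

lemma SG_cases:
  assumes "x \<in> SG q"
  obtains i y where "i < 3" "y \<in> SG q" "x = sg_map q i y"
  using assms by (subst (asm) SG_invariant) blast

lemma V_subset_SG: "V q m \<subseteq> SG q"
  unfolding SG_eq by (rule order_trans[OF _ closure_subset]) blast

lemma vertex_in_SG: "i < 3 \<Longrightarrow> q i \<in> SG q"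
  by (rule subsetD[OF V_subset_SG vertex_in_V])

lemma sg_map_funpow_vertex_in_V: "i < 3 \<Longrightarrow> j < 3 \<Longrightarrow> (sg_map q i ^^ m) (q j) \<in> V q m"
  by (induction m) auto

lemma sg_map_funpow_vertex_in_SG: "i < 3 \<Longrightarrow> j < 3 \<Longrightarrow> (sg_map q i ^^ m) (q j) \<in> SG q"
  by (rule subsetD[OF V_subset_SG sg_map_funpow_vertex_in_V])

section \<open>Cells: diameter, closedness and covering\<close>

lemma dist_word_map: "dist (word_map q w x) (word_map q w y) = dist x y / 2 ^ length w"
  by (induction w) (auto simp: dist_sg_map)

lemma continuous_on_word_map: "continuous_on S (word_map q w)"
proof (induction w)
  case (Cons i w)
  then show ?case
    unfolding word_map.simps by (intro continuous_on_compose continuous_on_sg_map)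
qed (simp add: id_def)

lemma cell_subset_SG: "set w \<subseteq> {..<3} \<Longrightarrow> cell q w \<subseteq> SG q"
  by (induction w) (auto simp: cell_def intro!: sg_map_in_SG)

lemma closed_cell: "closed (cell q w)"
  unfolding cell_def
  by (intro compact_imp_closed compact_continuous_image continuous_on_word_map compact_SG)

lemma ex_cell: "x \<in> SG q \<Longrightarrow> \<exists>w\<in>words m. x \<in> cell q w"
proof (induction m arbitrary: x)
  case 0
  then show ?case
    by (auto simp: words_def cell_def)
next
  case (Suc m)
  then obtain i y where y: "i < 3" "y \<in> SG q" "x = sg_map q i y"
    using SG_cases by metis
  then obtain w where "w \<in> words m" "y \<in> cell q w"
    using Suc.IH by blast
  then show ?case
    using y by (intro bexI[of _ "i # w"]) (auto simp: words_def cell_def)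
qed

text \<open>A cell of level \<open>m\<close> has diameter at most \<open>D / 2 ^ m\<close>, where
  \<open>D\<close> bounds the diameter of the gasket. This supplies sets of known positive measure
  near any given point.\<close>

lemma ex_cell_in_ball:
  assumes "x \<in> SG q" "e > 0"
  obtains m w where "w \<in> words m" "cell q w \<subseteq> ball x e"
proof -
  obtain D where D: "dist y z \<le> D" if "y \<in> SG q" "z \<in> SG q" for y z
    using compact_imp_bounded[OF compact_SG] bounded_two_points by metis
  obtain m where m: "D / 2 ^ m < e"
    using ex_divide_two_power_less[OF \<open>e > 0\<close>] by blast
  obtain w where w: "w \<in> words m" "x \<in> cell q w"
    using ex_cell assms by blast
  have "dist x y < e" if y: "y \<in> cell q w" for y
  proof -
    obtain x' where x': "x' \<in> SG q" "x = word_map q w x'"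
      using w(2) by (auto simp: cell_def)
    obtain y' where y': "y' \<in> SG q" "y = word_map q w y'"
      using y by (auto simp: cell_def)
    have "dist x y = dist x' y' / 2 ^ m"
      using w(1) by (simp add: x' y' dist_word_map words_def)
    also have "\<dots> \<le> D / 2 ^ m"
      using D[OF x'(1) y'(1)] by (intro divide_right_mono) auto
    finally show ?thesis
      using m by simp
  qed
  then have "cell q w \<subseteq> ball x e"
    by auto
  then show ?thesis
    using that w(1) by blast
qed

section \<open>Linearity of the Laplacian\<close>

lemma laplacian_level_cong:
  assumes "\<And>x. x \<in> SG q \<Longrightarrow> u x = v x" "x \<in> SG q"
  shows "laplacian_level q m u x = laplacian_level q m v x"
proof -
  have "(\<Sum>y\<in>{y. adjacent q m x y}. u y - u x) = (\<Sum>y\<in>{y. adjacent q m x y}. v y - v x)"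
    using assms V_subset_SG by (intro sum.cong) (auto simp: adjacent_def)
  then show ?thesis
    by (simp add: laplacian_level_def)
qed

lemma has_laplacian_cong:
  assumes "has_laplacian q u f"
    and "\<And>x. x \<in> SG q \<Longrightarrow> u x = v x" "\<And>x. x \<in> SG q \<Longrightarrow> f x = g x"
  shows "has_laplacian q v g"
proof -
  have "continuous_on (SG q) v" "continuous_on (SG q) g"
    using assms continuous_on_cong[of "SG q" "SG q"] unfolding has_laplacian_def by metis+
  moreover have "laplacian_level q m v x - g x = laplacian_level q m u x - f x" if "x \<in> V q m" for m x
    using that assms(2,3) laplacian_level_cong[of q u v x m] V_subset_SG[of q m] by force
  ultimately show ?thesis
    using assms(1) unfolding has_laplacian_def by (metis DiffD1)
qed

lemma has_laplacian_add:
  assumes "has_laplacian q u f" "has_laplacian q v g"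
  shows "has_laplacian q (\<lambda>x. u x + v x) (\<lambda>x. f x + g x)"
  unfolding has_laplacian_def
proof (intro conjI allI impI)
  show "continuous_on (SG q) (\<lambda>x. u x + v x)" "continuous_on (SG q) (\<lambda>x. f x + g x)"
    using assms by (auto simp: has_laplacian_def intro!: continuous_intros)
  fix e :: real assume "e > 0"
  then have "e / 2 > 0"
    by simp
  then obtain M N where M: "\<forall>m\<ge>M. \<forall>x\<in>V q m - V q 0. \<bar>laplacian_level q m u x - f x\<bar> < e / 2"
    and N: "\<forall>m\<ge>N. \<forall>x\<in>V q m - V q 0. \<bar>laplacian_level q m v x - g x\<bar> < e / 2"
    using assms unfolding has_laplacian_def by blast
  have eq: "laplacian_level q m (\<lambda>x. u x + v x) x = laplacian_level q m u x + laplacian_level q m v x"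
    for m x
    by (simp add: laplacian_level_def algebra_simps sum.distrib sum_subtractf)
  have "\<bar>laplacian_level q m (\<lambda>x. u x + v x) x - (f x + g x)\<bar> < e"
    if "m \<ge> max M N" "x \<in> V q m - V q 0" for m x
  proof -
    have "\<bar>laplacian_level q m u x - f x\<bar> < e / 2" "\<bar>laplacian_level q m v x - g x\<bar> < e / 2"
      using M N that by auto
    then show ?thesis
      unfolding eq by linarith
  qed
  then show "\<exists>N. \<forall>m\<ge>N. \<forall>x\<in>V q m - V q 0.
      \<bar>laplacian_level q m (\<lambda>x. u x + v x) x - (f x + g x)\<bar> < e"
    by blast
qed

lemma has_laplacian_scale:
  assumes "has_laplacian q u f"
  shows "has_laplacian q (\<lambda>x. a * u x) (\<lambda>x. a * f x)"
  unfolding has_laplacian_def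
proof (intro conjI allI impI)
  show "continuous_on (SG q) (\<lambda>x. a * u x)" "continuous_on (SG q) (\<lambda>x. a * f x)"
    using assms by (auto simp: has_laplacian_def intro!: continuous_intros)
  fix e :: real assume "e > 0"
  \<comment> \<open>Adding 1 keeps the denominator positive when \<open>a = 0\<close>.\<close>
  then have "e / (\<bar>a\<bar> + 1) > 0"
    by simp
  then obtain N where N: "\<forall>m\<ge>N. \<forall>x\<in>V q m - V q 0. \<bar>laplacian_level q m u x - f x\<bar> < e / (\<bar>a\<bar> + 1)"
    using assms unfolding has_laplacian_def by blast
  have "\<bar>laplacian_level q m (\<lambda>x. a * u x) x - a * f x\<bar> < e"
    if "m \<ge> N" "x \<in> V q m - V q 0" for m x
  proof -
    have "laplacian_level q m (\<lambda>x. a * u x) x = a * laplacian_level q m u x"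
      by (simp add: laplacian_level_def flip: right_diff_distrib sum_distrib_left)
    then have "\<bar>laplacian_level q m (\<lambda>x. a * u x) x - a * f x\<bar> = \<bar>a\<bar> * \<bar>laplacian_level q m u x - f x\<bar>"
      by (simp flip: right_diff_distrib abs_mult)
    also have "\<dots> \<le> (\<bar>a\<bar> + 1) * \<bar>laplacian_level q m u x - f x\<bar>"
      by (intro mult_right_mono) auto
    also have "\<dots> < e"
      using N that by (auto simp: pos_less_divide_eq add_pos_nonneg mult.commute)
    finally show ?thesis .
  qed
  then show "\<exists>N. \<forall>m\<ge>N. \<forall>x\<in>V q m - V q 0. \<bar>laplacian_level q m (\<lambda>x. a * u x) x - a * f x\<bar> < e"
    by blast
qed

lemma has_laplacian_diff:
  assumes "has_laplacian q u f" "has_laplacian q v g"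
  shows "has_laplacian q (\<lambda>x. u x - v x) (\<lambda>x. f x - g x)"
  using has_laplacian_add[OF assms(1) has_laplacian_scale[OF assms(2), of "-1"]] by simp

lemma has_laplacian_zero: "has_laplacian q (\<lambda>x. 0) (\<lambda>x. 0)"
  by (simp add: has_laplacian_def laplacian_level_def)

lemma has_laplacian_sum:
  assumes "finite A" "\<And>i. i \<in> A \<Longrightarrow> has_laplacian q (u i) (f i)"
  shows "has_laplacian q (\<lambda>x. \<Sum>i\<in>A. a i * u i x) (\<lambda>x. \<Sum>i\<in>A. a i * f i x)"
  using assms
proof (induction A rule: finite_induct)
  case empty
  then show ?case
    by (simp add: has_laplacian_zero)
next
  case (insert i A)
  then show ?case
    using has_laplacian_add[OF has_laplacian_scale[of q "u i" "f i" "a i"]] by simp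
qed

section \<open>Powers of the Laplacian\<close>

lemma has_laplacian_pow_cong:
  assumes "has_laplacian_pow q n u f"
    and "\<And>x. x \<in> SG q \<Longrightarrow> u x = v x" "\<And>x. x \<in> SG q \<Longrightarrow> f x = g x"
  shows "has_laplacian_pow q n v g"
  using assms(1,2)
proof (induction n arbitrary: u v)
  case (Suc n)
  then obtain h where h: "has_laplacian q u h" "has_laplacian_pow q n h f"
    by auto
  have "has_laplacian q v h"
    using has_laplacian_cong[OF h(1)] Suc.prems by blast
  moreover have "has_laplacian_pow q n h g"
    using Suc.IH[OF h(2)] by blast
  ultimately show ?case
    by auto
qed (use assms in auto)

lemma has_laplacian_pow_add:
  "has_laplacian_pow q n u f \<Longrightarrow> has_laplacian_pow q n v g \<Longrightarrow>
     has_laplacian_pow q n (\<lambda>x. u x + v x) (\<lambda>x. f x + g x)"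
  by (induction n arbitrary: u v) (auto intro: has_laplacian_add)

lemma has_laplacian_pow_scale:
  "has_laplacian_pow q n u f \<Longrightarrow> has_laplacian_pow q n (\<lambda>x. a * u x) (\<lambda>x. a * f x)"
  by (induction n arbitrary: u) (auto intro: has_laplacian_scale)

lemma has_laplacian_pow_zero: "has_laplacian_pow q n (\<lambda>x. 0) (\<lambda>x. 0)"
  by (induction n) (auto intro: has_laplacian_zero)

lemma has_laplacian_pow_sum:
  assumes "finite A" "\<And>i. i \<in> A \<Longrightarrow> has_laplacian_pow q n (u i) (f i)"
  shows "has_laplacian_pow q n (\<lambda>x. \<Sum>i\<in>A. a i * u i x) (\<lambda>x. \<Sum>i\<in>A. a i * f i x)"
  using assms
proof (induction A rule: finite_induct)
  case empty
  then show ?case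
    by (simp add: has_laplacian_pow_zero)
next
  case (insert i A)
  then show ?case
    using has_laplacian_pow_add[OF has_laplacian_pow_scale[of q n "u i" "f i" "a i"]] by simp
qed

lemma has_laplacian_pow_trans:
  "has_laplacian_pow q m u v \<Longrightarrow> has_laplacian_pow q n v w \<Longrightarrow> has_laplacian_pow q (m + n) u w"
proof (induction m arbitrary: u)
  case 0
  then show ?case
    using has_laplacian_pow_cong[of q n v w u w] by simp
qed auto

lemma has_laplacian_pow_zero_mono:
  assumes "has_laplacian_pow q m u (\<lambda>x. 0)" "m \<le> n"
  shows "has_laplacian_pow q n u (\<lambda>x. 0)"
  using has_laplacian_pow_trans[OF assms(1) has_laplacian_pow_zero[of q "n - m"]] assms(2) by simp

lemma sg_polynomial_continuous: "sg_polynomial q n u \<Longrightarrow> continuous_on (SG q) u"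
  by (auto simp: sg_polynomial_def has_laplacian_def)

lemma has_tangential_deriv_cong:
  assumes "has_tangential_deriv q u a" "\<And>x. x \<in> SG q \<Longrightarrow> u x = v x"
  shows "has_tangential_deriv q v a"
  using assms sg_map_funpow_vertex_in_SG[where q = q and i = 0] by (simp add: has_tangential_deriv_def)

section \<open>Uniqueness of the Laplacian and reflection symmetry\<close>

locale equilateral_triangle =
  fixes q :: "nat \<Rightarrow> plane"
  assumes triangle: "equilateral q"
begin

lemma vertices_distinct: "i < 3 \<Longrightarrow> j < 3 \<Longrightarrow> i \<noteq> j \<Longrightarrow> q i \<noteq> q j"
proof -
  have "q 0 \<noteq> q 1" "q 0 \<noteq> q 2" "q 1 \<noteq> q 2"
    using triangle unfolding equilateral_def by (metis dist_eq_0_iff)+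
  moreover assume "i < 3" "j < 3" "i \<noteq> j"
  then have "i = 0 \<or> i = 1 \<or> i = 2" "j = 0 \<or> j = 1 \<or> j = 2"
    by auto
  ultimately show ?thesis
    using \<open>i \<noteq> j\<close> by metis
qed

text \<open>The boundary points are limits of their neighbours \<open>F\<^sub>i\<^sup>n(q\<^sub>j)\<close>, so that removing
  them does not destroy density.\<close>

lemma SG_eq_closure_interior: "SG q = closure ((\<Union>m. V q m) - V q 0)"
proof
  have "x \<in> closure ((\<Union>m. V q m) - V q 0)" if "x \<in> V q m" for x m
  proof (cases "x \<in> V q 0")
    case True
    then obtain i where i: "i < 3" "x = q i"
      by auto
    obtain j where j: "j < 3" "j \<noteq> i"
      using that by (metis less_numeral_extra(3) zero_less_numeral one_less_numeral_iff semiring_norm(77) zero_neq_one)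
    define s where "s = (\<lambda>n. (sg_map q i ^^ n) (q j))"
    have lim: "s \<longlonglongrightarrow> x"
      unfolding s_def i by (rule sg_map_funpow_tendsto_vertex)
    have ne: "s n \<noteq> x" for n
      using dist_sg_map_funpow_vertex[where q = q and i = i and n = n and x = "q j"] vertices_distinct[OF j(1) i(1) j(2)] i(2)
      by (auto simp: s_def)
    \<comment> \<open>The sequence starts at another vertex, so it avoids the boundary only
      eventually: this neighbourhood of \<open>x\<close> excludes the other vertices, and
      \<open>ne\<close> excludes \<open>x\<close>.\<close>
    have nbhd: "open (- (V q 0 - {x}))"
      by (intro open_Compl finite_imp_closed) auto
    have "eventually (\<lambda>n. s n \<in> - (V q 0 - {x})) sequentially"
      by (rule topological_tendstoD[OF lim nbhd]) simp
    then have "eventually (\<lambda>n. s n \<in> closure ((\<Union>m. V q m) - V q 0)) sequentially"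
    proof eventually_elim
      case (elim n)
      have "s n \<in> V q n"
        using sg_map_funpow_vertex_in_V i j by (simp add: s_def)
      then have "s n \<in> (\<Union>m. V q m) - V q 0"
        using elim ne[of n] by blast
      then show ?case
        by (rule subsetD[OF closure_subset])
    qed
    then show ?thesis
      by (rule Lim_in_closed_set[OF closed_closure _ sequentially_bot lim])
  next
    case False
    then show ?thesis
      using that by (intro subsetD[OF closure_subset]) blast
  qed
  then show "SG q \<subseteq> closure ((\<Union>m. V q m) - V q 0)"
    unfolding SG_eq by (intro closure_minimal) auto
  show "closure ((\<Union>m. V q m) - V q 0) \<subseteq> SG q"
    unfolding SG_eq by (intro closure_mono) auto
qed

text \<open>At each vertex off the boundary both functions are the limit of the same discrete
  Laplacians. Density and continuity extend the equality to the whole gasket.\<close>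

lemma has_laplacian_unique:
  assumes "has_laplacian q u f" "has_laplacian q u g" "x \<in> SG q"
  shows "f x = g x"
proof -
  have "f y - g y = 0" if y: "y \<in> (\<Union>m. V q m) - V q 0" for y
  proof (rule ccontr)
    assume "f y - g y \<noteq> 0"
    then have pos: "\<bar>f y - g y\<bar> / 2 > 0"
      by simp
    obtain M N where M: "\<forall>m\<ge>M. \<forall>x\<in>V q m - V q 0. \<bar>laplacian_level q m u x - f x\<bar> < \<bar>f y - g y\<bar> / 2"
      and N: "\<forall>m\<ge>N. \<forall>x\<in>V q m - V q 0. \<bar>laplacian_level q m u x - g x\<bar> < \<bar>f y - g y\<bar> / 2"
      using assms(1,2) pos unfolding has_laplacian_def by blast
    obtain k where "y \<in> V q k"
      using y by blast
    \<comment> \<open>At this level both estimates apply and \<open>y\<close> is a vertex.\<close>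
    define m where "m = max k (max M N)"
    have "y \<in> V q m - V q 0"
      using \<open>y \<in> V q k\<close> V_mono[of k m q] y by (auto simp: m_def)
    then have "\<bar>laplacian_level q m u y - f y\<bar> < \<bar>f y - g y\<bar> / 2"
      and "\<bar>laplacian_level q m u y - g y\<bar> < \<bar>f y - g y\<bar> / 2"
      using M N by (auto simp: m_def)
    from add_strict_mono[OF this]
    have "\<bar>laplacian_level q m u y - f y\<bar> + \<bar>laplacian_level q m u y - g y\<bar> < \<bar>f y - g y\<bar>"
      by simp
    moreover have "\<bar>f y - g y\<bar> \<le> \<bar>laplacian_level q m u y - f y\<bar> + \<bar>laplacian_level q m u y - g y\<bar>"
      by arith
    ultimately show False
      by simp
  qed
  moreover have "continuous_on (closure ((\<Union>m. V q m) - V q 0)) (\<lambda>x. f x - g x)"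
    using assms(1,2) unfolding SG_eq_closure_interior[symmetric] has_laplacian_def
    by (intro continuous_intros) auto
  ultimately have "f x - g x = 0"
    using continuous_constant_on_closure assms(3) unfolding SG_eq_closure_interior by blast
  then show ?thesis
    by simp
qed

text \<open>The intermediate Laplacians are determined only on the gasket, so the induction passes
  from one choice to the other by congruence.\<close>

lemma has_laplacian_pow_unique:
  "has_laplacian_pow q n u f \<Longrightarrow> has_laplacian_pow q n u g \<Longrightarrow> x \<in> SG q \<Longrightarrow> f x = g x"
proof (induction n arbitrary: u)
  case (Suc n)
  obtain v where v: "has_laplacian q u v" "has_laplacian_pow q n v f"
    using Suc.prems by auto
  obtain w where w: "has_laplacian q u w" "has_laplacian_pow q n w g"
    using Suc.prems by auto
  have "has_laplacian_pow q n v g"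
    using has_laplacian_pow_cong[OF w(2)] has_laplacian_unique[OF w(1) v(1)] by blast
  then show ?case
    using Suc.IH v(2) Suc.prems(3) by blast
qed auto

text \<open>The orthogonal reflection in the altitude of the triangle through
  \<open>q 0\<close>.\<close>

definition reflect :: "plane \<Rightarrow> plane" where
  "reflect x = x - (2 * ((x - q 0) \<bullet> (q 1 - q 2)) / ((q 1 - q 2) \<bullet> (q 1 - q 2))) *\<^sub>R (q 1 - q 2)"

abbreviation swap :: "nat \<Rightarrow> nat" where
  "swap \<equiv> Transposition.transpose 1 2"

text \<open>The reflection is affine. Midpoints suffice here, since each contraction sends a point
  to its midpoint with a vertex.\<close>

lemma reflect_midpoint:
  "reflect ((1/2) *\<^sub>R x + (1/2) *\<^sub>R y) = (1/2) *\<^sub>R reflect x + (1/2) *\<^sub>R reflect y"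
proof -
  define e where "e = q 1 - q 2"
  define c where "c = (\<lambda>x. 2 * ((x - q 0) \<bullet> e) / (e \<bullet> e))"
  have c: "reflect x = x - c x *\<^sub>R e" for x
    by (simp add: reflect_def c_def e_def)
  have "((1/2) *\<^sub>R x + (1/2) *\<^sub>R y - q 0) \<bullet> e = ((x - q 0) \<bullet> e + (y - q 0) \<bullet> e) / 2"
    by (simp add: inner_diff_left inner_add_left field_simps)
  then have "c ((1/2) *\<^sub>R x + (1/2) *\<^sub>R y) = (1/2) * c x + (1/2) * c y"
    by (simp add: c_def add_divide_distrib)
  then show ?thesis
    unfolding c by (simp add: scaleR_diff_right scaleR_add_left)
qed

lemma swap_less_3: "i < 3 \<Longrightarrow> swap i < 3"
  by (auto simp: Transposition.transpose_def)

text \<open>Equality of the sides \<open>a\<close> and \<open>b\<close> at \<open>q 0\<close> makes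
  the coefficient of \<open>q 1 - q 2\<close> equal to 1 at \<open>q 1\<close> and -1 at
  \<open>q 2\<close>.\<close>

lemma reflect_vertex:
  assumes "i < 3"
  shows "reflect (q i) = q (swap i)"
proof -
  define a b where "a = q 1 - q 0" and "b = q 2 - q 0"
  have e: "q 1 - q 2 = a - b"
    by (simp add: a_def b_def)
  have "norm a = norm b"
    using triangle by (simp add: equilateral_def a_def b_def dist_norm norm_minus_commute)
  then have ab: "a \<bullet> a = b \<bullet> b"
    by (simp add: dot_square_norm)
  have "q 1 \<noteq> q 2"
    by (intro vertices_distinct) auto
  then have nz: "(a - b) \<bullet> (a - b) \<noteq> 0"
    using e by auto
  have "2 * (a \<bullet> (a - b)) = (a - b) \<bullet> (a - b)" "2 * (b \<bullet> (a - b)) = - ((a - b) \<bullet> (a - b))"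
    using ab by (simp_all add: inner_diff_left inner_diff_right inner_commute)
  then have "reflect (q 1) = q 2" "reflect (q 2) = q 1"
    using nz unfolding reflect_def e by (simp_all add: a_def b_def)
  moreover have "reflect (q 0) = q 0"
    by (simp add: reflect_def)
  moreover have "i = 0 \<or> i = 1 \<or> i = 2"
    using assms by auto
  ultimately show ?thesis
    by (auto simp: Transposition.transpose_def)
qed

text \<open>The coefficient \<open>c\<close> changes sign under reflection, so the two displacements
  cancel.\<close>

lemma reflect_reflect [simp]: "reflect (reflect x) = x"
proof -
  define e where "e = q 1 - q 2"
  define c where "c = (\<lambda>x. 2 * ((x - q 0) \<bullet> e) / (e \<bullet> e))"
  have c: "reflect x = x - c x *\<^sub>R e" for x
    by (simp add: reflect_def c_def e_def)
  have "q 1 \<noteq> q 2"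
    by (intro vertices_distinct) auto
  then have "e \<bullet> e \<noteq> 0"
    by (simp add: e_def)
  have "(x - c x *\<^sub>R e - q 0) \<bullet> e = (x - q 0) \<bullet> e - c x * (e \<bullet> e)"
    by (simp add: inner_diff_left)
  also have "c x * (e \<bullet> e) = 2 * ((x - q 0) \<bullet> e)"
    using \<open>e \<bullet> e \<noteq> 0\<close> by (simp add: c_def)
  finally have "c (x - c x *\<^sub>R e) = - c x"
    by (simp add: c_def)
  then show ?thesis
    unfolding c by simp
qed

lemma continuous_on_reflect: "continuous_on S reflect"
  unfolding reflect_def divide_inverse by (intro continuous_intros)

lemma reflect_sg_map: "i < 3 \<Longrightarrow> reflect (sg_map q i x) = sg_map q (swap i) (reflect x)"
  by (simp add: sg_map_midpoint reflect_midpoint reflect_vertex)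

lemma reflect_sg_map_funpow: "reflect ((sg_map q 0 ^^ m) x) = (sg_map q 0 ^^ m) (reflect x)"
  by (induction m) (auto simp: reflect_sg_map)

lemma reflect_word_map:
  "set w \<subseteq> {..<3} \<Longrightarrow> reflect (word_map q w x) = word_map q (map swap w) (reflect x)"
  by (induction w) (auto simp: reflect_sg_map)

lemma reflect_in_V: "x \<in> V q m \<Longrightarrow> reflect x \<in> V q m"
proof (induction m arbitrary: x)
  case 0
  then show ?case
    using reflect_vertex swap_less_3 by auto
next
  case (Suc m)
  then obtain i y where y: "i < 3" "y \<in> V q m" "x = sg_map q i y"
    by auto
  then have "reflect x = sg_map q (swap i) (reflect y)" "reflect y \<in> V q m"
    using reflect_sg_map Suc.IH by auto
  then show ?case
    using swap_less_3[OF y(1)] by auto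
qed

lemma reflect_in_V_iff: "reflect x \<in> V q m \<longleftrightarrow> x \<in> V q m"
  using reflect_in_V[of x m] reflect_in_V[of "reflect x" m] by auto

lemma reflect_in_SG:
  assumes "x \<in> SG q"
  shows "reflect x \<in> SG q"
proof -
  have "reflect ` closure (\<Union>m. V q m) \<subseteq> SG q"
    using reflect_in_V subsetD[OF V_subset_SG]
    by (intro image_closure_subset continuous_on_reflect compact_imp_closed compact_SG) blast
  then show ?thesis
    using assms unfolding SG_eq[of q] by blast
qed

lemma reflect_in_cell:
  assumes "w \<in> words m" "x \<in> cell q w"
  shows "map swap w \<in> words m" "reflect x \<in> cell q (map swap w)"
  using assms reflect_word_map[of w] reflect_in_SG swap_less_3
  by (auto simp: words_def cell_def subset_iff)

lemma adjacent_reflect: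
  assumes "adjacent q m x y"
  shows "adjacent q m (reflect x) (reflect y)"
proof -
  obtain w where "w \<in> words m" "x \<in> cell q w" "y \<in> cell q w"
    using assms by (auto simp: adjacent_def)
  then have "map swap w \<in> words m" "reflect x \<in> cell q (map swap w)" "reflect y \<in> cell q (map swap w)"
    using reflect_in_cell by blast+
  moreover have "reflect x \<noteq> reflect y"
    using assms reflect_reflect unfolding adjacent_def by metis
  ultimately show ?thesis
    using assms by (auto simp: adjacent_def reflect_in_V_iff)
qed

lemma adjacent_reflect_left: "adjacent q m (reflect x) y \<longleftrightarrow> adjacent q m x (reflect y)"
  using adjacent_reflect[of m "reflect x" y] adjacent_reflect[of m x "reflect y"] by auto

text \<open>The reflection is an automorphism of the level \<open>m\<close> graph, so it merely
  reindexes the sum over neighbours.\<close>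

lemma laplacian_level_reflect:
  "laplacian_level q m (\<lambda>x. u (reflect x)) x = laplacian_level q m u (reflect x)"
proof -
  have "(\<Sum>y\<in>{y. adjacent q m x y}. u (reflect y) - u (reflect x)) =
      (\<Sum>y\<in>{y. adjacent q m (reflect x) y}. u y - u (reflect x))"
    by (rule sum.reindex_bij_witness[of _ reflect reflect]) (auto simp: adjacent_reflect_left)
  then show ?thesis
    by (simp add: laplacian_level_def)
qed

lemma has_laplacian_reflect:
  assumes "has_laplacian q u f"
  shows "has_laplacian q (\<lambda>x. u (reflect x)) (\<lambda>x. f (reflect x))"
proof -
  have "continuous_on (SG q) (\<lambda>x. g (reflect x))" if "continuous_on (SG q) g" for g :: "plane \<Rightarrow> real"
    using reflect_in_SG by (intro continuous_on_compose2[OF that] continuous_on_reflect) auto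
  moreover have "x \<in> V q m - V q 0 \<Longrightarrow> reflect x \<in> V q m - V q 0" for x m
    using reflect_in_V_iff by blast
  ultimately show ?thesis
    using assms unfolding has_laplacian_def laplacian_level_reflect by meson
qed

lemma has_laplacian_neg_reflect:
  assumes "has_laplacian q u f"
  shows "has_laplacian q (\<lambda>x. - u (reflect x)) (\<lambda>x. - f (reflect x))"
  using has_laplacian_scale[OF has_laplacian_reflect[OF assms], of "-1"] by simp

lemma has_laplacian_pow_neg_reflect:
  "has_laplacian_pow q n u f \<Longrightarrow> has_laplacian_pow q n (\<lambda>x. - u (reflect x)) (\<lambda>x. - f (reflect x))"
proof (induction n arbitrary: u)
  case 0
  then show ?case
    by (auto simp: reflect_in_SG)
next
  case (Suc n)
  then obtain v where "has_laplacian q u v" "has_laplacian_pow q n v f"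
    by auto
  then show ?case
    using has_laplacian_neg_reflect Suc.IH by auto
qed

lemma reflect_funpow_vertex:
  "reflect ((sg_map q 0 ^^ m) (q 0)) = (sg_map q 0 ^^ m) (q 0)"
  "reflect ((sg_map q 0 ^^ m) (q 1)) = (sg_map q 0 ^^ m) (q 2)"
  "reflect ((sg_map q 0 ^^ m) (q 2)) = (sg_map q 0 ^^ m) (q 1)"
  by (simp_all add: reflect_sg_map_funpow reflect_vertex)

text \<open>Reflection exchanges the points \<open>(sg_map q 0 ^^ m) (q 1)\<close> and
  \<open>(sg_map q 0 ^^ m) (q 2)\<close>. It therefore keeps normal derivatives and negates
  tangential ones. The outer minus sign restores the tangential derivative and leaves the zero
  conditions intact.\<close>

lemma antisym_monomial_conds_neg_reflect:
  assumes "antisym_monomial_conds q j u"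
  shows "antisym_monomial_conds q j (\<lambda>x. - u (reflect x))"
  unfolding antisym_monomial_conds_def
proof (intro conjI allI impI)
  show "sg_polynomial q j (\<lambda>x. - u (reflect x))"
    using assms has_laplacian_pow_neg_reflect[of "Suc j" u "\<lambda>x. 0"]
    by (simp add: antisym_monomial_conds_def sg_polynomial_def)
  fix m assume "m \<le> j"
  then obtain v where v: "has_laplacian_pow q m u v" "v (q 0) = 0" "has_normal_deriv q v 0"
      "has_tangential_deriv q v (if m = j then 1 else 0)"
    using assms by (auto simp: antisym_monomial_conds_def)
  have q0: "reflect (q 0) = q 0"
    by (simp add: reflect_vertex)
  have "has_normal_deriv q (\<lambda>x. - v (reflect x)) 0"
    using tendsto_minus[OF v(3)[unfolded has_normal_deriv_def]]
    by (simp add: has_normal_deriv_def reflect_funpow_vertex[simplified] q0 algebra_simps)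
  moreover have "has_tangential_deriv q (\<lambda>x. - v (reflect x)) (if m = j then 1 else 0)"
    using v(4) by (simp add: has_tangential_deriv_def reflect_funpow_vertex[simplified])
  ultimately show "\<exists>w. has_laplacian_pow q m (\<lambda>x. - u (reflect x)) w \<and> w (q 0) = 0 \<and>
      has_normal_deriv q w 0 \<and> has_tangential_deriv q w (if m = j then 1 else 0)"
    using has_laplacian_pow_neg_reflect[OF v(1)] v(2) q0 by (intro exI conjI) auto
qed

end

section \<open>The inner product and Green's operator\<close>

locale gasket_measure = equilateral_triangle +
  fixes \<mu> :: "plane measure"
  assumes measure: "sg_measure q \<mu>"
begin

sublocale prob_space \<mu>
  using measure by (simp add: sg_measure_def)

sublocale square: pair_prob_space \<mu> \<mu> ..

lemma sets_\<mu>: "sets \<mu> = sets (restrict_space borel (SG q))"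
  using measure by (simp add: sg_measure_def)

lemma space_\<mu>: "space \<mu> = SG q"
  using sets_eq_imp_space_eq[OF sets_\<mu>] by (simp add: space_restrict_space)

lemma borel_measurable_continuous:
  fixes u :: "plane \<Rightarrow> 'b::topological_space"
  shows "continuous_on (SG q) u \<Longrightarrow> u \<in> borel_measurable \<mu>"
  using measurable_cong_sets[OF sets_\<mu> refl] borel_measurable_continuous_on_restrict by blast

lemma integrable_continuous:
  fixes u :: "plane \<Rightarrow> real"
  assumes "continuous_on (SG q) u"
  shows "integrable \<mu> u"
proof -
  obtain B where "norm (u x) \<le> B" if "x \<in> SG q" for x
    using compact_imp_bounded[OF compact_continuous_image[OF assms compact_SG]]
    by (auto simp: bounded_iff)
  then show ?thesis
    by (intro integrable_const_bound[where B = B] borel_measurable_continuous assms AE_I2)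
      (simp add: space_\<mu>)
qed

lemma integrable_continuous_square:
  fixes F :: "plane \<times> plane \<Rightarrow> real"
  assumes "continuous_on (SG q \<times> SG q) F"
  shows "integrable (\<mu> \<Otimes>\<^sub>M \<mu>) F"
proof -
  have "compact (SG q \<times> SG q)"
    by (intro compact_Times compact_SG)
  then obtain B where B: "norm (F z) \<le> B" if "z \<in> SG q \<times> SG q" for z
    using compact_imp_bounded[OF compact_continuous_image[OF assms]]
    by (auto simp: bounded_iff)
  \<comment> \<open>Continuity is known only on the compact product, so \<open>F\<close> is extended
    by zero to a Borel function and then composed with the measurable inclusion.\<close>
  have "(\<lambda>z. indicator (SG q \<times> SG q) z *\<^sub>R F z) \<in> borel_measurable borel"
    using \<open>compact (SG q \<times> SG q)\<close>
    by (intro borel_measurable_continuous_on_indicator assms) (auto intro: borel_compact)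
  moreover have "(\<lambda>z. (fst z, snd z)) \<in> borel_measurable (\<mu> \<Otimes>\<^sub>M \<mu>)"
    by (intro borel_measurable_Pair measurable_compose[OF measurable_fst] measurable_compose[OF measurable_snd]
        borel_measurable_continuous continuous_on_id)
  ultimately have "(\<lambda>z. indicator (SG q \<times> SG q) z *\<^sub>R F z) \<in> borel_measurable (\<mu> \<Otimes>\<^sub>M \<mu>)"
    using measurable_compose by fastforce
  then have "F \<in> borel_measurable (\<mu> \<Otimes>\<^sub>M \<mu>)"
    by (rule measurable_cong[THEN iffD1, rotated]) (auto simp: space_pair_measure space_\<mu>)
  then show ?thesis
    using B by (intro square.P.integrable_const_bound[where B = B] AE_I2)
      (auto simp: space_pair_measure space_\<mu>)
qed

section \<open>Linearity and positivity of the inner product\<close>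

lemma l2_inner_cong:
  assumes "\<And>x. x \<in> SG q \<Longrightarrow> u x = u' x" "\<And>x. x \<in> SG q \<Longrightarrow> v x = v' x"
  shows "l2_inner \<mu> u v = l2_inner \<mu> u' v'"
  unfolding l2_inner_def using assms by (intro Bochner_Integration.integral_cong) (auto simp: space_\<mu>)

lemma l2_inner_commute: "l2_inner \<mu> u v = l2_inner \<mu> v u"
  by (simp add: l2_inner_def mult.commute)

lemma l2_inner_add_left:
  assumes "continuous_on (SG q) u" "continuous_on (SG q) v" "continuous_on (SG q) w"
  shows "l2_inner \<mu> (\<lambda>x. u x + v x) w = l2_inner \<mu> u w + l2_inner \<mu> v w"
  unfolding l2_inner_def distrib_right
  by (intro Bochner_Integration.integral_add integrable_continuous continuous_intros assms)

lemma l2_inner_sum_left: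
  assumes "\<And>i. i \<in> A \<Longrightarrow> continuous_on (SG q) (u i)" "continuous_on (SG q) w"
  shows "l2_inner \<mu> (\<lambda>x. \<Sum>i\<in>A. a i * u i x) w = (\<Sum>i\<in>A. a i * l2_inner \<mu> (u i) w)"
proof -
  have "l2_inner \<mu> (\<lambda>x. \<Sum>i\<in>A. a i * u i x) w = (LINT x|\<mu>. (\<Sum>i\<in>A. a i * (u i x * w x)))"
    by (simp add: l2_inner_def sum_distrib_right mult.assoc)
  also have "\<dots> = (\<Sum>i\<in>A. (LINT x|\<mu>. a i * (u i x * w x)))"
    by (intro Bochner_Integration.integral_sum integrable_continuous continuous_intros assms)
  finally show ?thesis
    by (simp add: l2_inner_def)
qed

text \<open>Every cell has positive measure, so a continuous function that vanishes almost everywhere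
  vanishes on the gasket.\<close>

lemma l2_inner_self_pos:
  assumes cont: "continuous_on (SG q) u" and x: "x \<in> SG q" "u x \<noteq> 0"
  shows "l2_inner \<mu> u u > 0"
proof -
  have int: "integrable \<mu> (\<lambda>x. u x * u x)"
    by (intro integrable_continuous continuous_intros cont)
  have "l2_inner \<mu> u u \<noteq> 0"
  proof
    assume "l2_inner \<mu> u u = 0"
    then have ae: "AE x in \<mu>. u x = 0"
      using integral_nonneg_eq_0_iff_AE[OF int] by (simp add: l2_inner_def)
    obtain e where e: "e > 0" "\<And>y. y \<in> SG q \<Longrightarrow> dist y x < e \<Longrightarrow> u y \<noteq> 0"
      using continuous_on_avoid[OF cont x] by (metis dist_commute)
    obtain m w where w: "w \<in> words m" "cell q w \<subseteq> ball x e"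
      using ex_cell_in_ball[OF x(1) e(1)] by metis
    have sub: "cell q w \<subseteq> SG q"
      using w(1) cell_subset_SG[of w q] by (auto simp: words_def)
    have nz: "u y \<noteq> 0" if "y \<in> cell q w" for y
      using e(2)[of y] w(2) sub that by (auto simp: subset_iff dist_commute)
    have "cell q w \<in> sets \<mu>"
      using sub closed_cell[of q w] unfolding sets_\<mu> by (auto simp: sets_restrict_space image_iff)
    moreover have "AE x in \<mu>. x \<notin> cell q w"
      using ae by eventually_elim (use nz in blast)
    ultimately have "measure \<mu> (cell q w) = 0"
      using prob_eq_0 by blast
    then show False
      using measure w(1) by (auto simp: sg_measure_def)
  qed
  moreover have "l2_inner \<mu> u u \<ge> 0"
    by (simp add: l2_inner_def)
  ultimately show ?thesis
    by simp
qed

end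

locale gasket_green = gasket_measure +
  fixes G :: "plane \<Rightarrow> plane \<Rightarrow> real"
  assumes green: "is_green_function q \<mu> G"
begin

abbreviation green_op :: "(plane \<Rightarrow> real) \<Rightarrow> plane \<Rightarrow> real" where
  "green_op u x \<equiv> LINT y|\<mu>. G x y * u y"

lemma solves_dirichlet_green_op: "continuous_on (SG q) u \<Longrightarrow> solves_dirichlet q u (green_op u)"
  using green by (simp add: is_green_function_def)

lemma solves_dirichlet_unique:
  "continuous_on (SG q) f \<Longrightarrow> solves_dirichlet q f u \<Longrightarrow> x \<in> SG q \<Longrightarrow> u x = green_op f x"
  using green by (simp add: is_green_function_def)

text \<open>This is uniqueness for the Dirichlet problem with right-hand side 0, whose Green
  integral vanishes.\<close>

lemma harmonic_zero_boundary:
  assumes "has_laplacian q u (\<lambda>x. 0)" "\<And>i. i < 3 \<Longrightarrow> u (q i) = 0" "x \<in> SG q"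
  shows "u x = 0"
proof -
  have "solves_dirichlet q (\<lambda>x. 0) u"
    using assms by (auto simp: solves_dirichlet_def)
  then show ?thesis
    using solves_dirichlet_unique[of "\<lambda>x. 0" u x] assms(3) by simp
qed

lemma has_laplacian_neg_green_op:
  assumes "continuous_on (SG q) u"
  shows "has_laplacian q (\<lambda>x. - green_op u x) u"
  using has_laplacian_scale[of q "green_op u" "\<lambda>x. - u x" "-1"] solves_dirichlet_green_op[OF assms]
  by (simp add: solves_dirichlet_def)

text \<open>The negated reflection of \<open>green_op u\<close> solves the same Dirichlet problem,
  because \<open>u\<close> is antisymmetric and the reflection preserves the boundary.\<close>

lemma green_op_antisym:
  assumes cont: "continuous_on (SG q) u" and antisym: "\<And>x. x \<in> SG q \<Longrightarrow> u (reflect x) = - u x"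
    and x: "x \<in> SG q"
  shows "green_op u (reflect x) = - green_op u x"
proof -
  have u: "has_laplacian q (green_op u) (\<lambda>x. - u x)" "\<forall>x\<in>V q 0. green_op u x = 0"
    using solves_dirichlet_green_op[OF cont] by (auto simp: solves_dirichlet_def)
  have "has_laplacian q (\<lambda>x. - green_op u (reflect x)) (\<lambda>x. - u x)"
    using has_laplacian_neg_reflect[OF u(1)]
    by (rule has_laplacian_cong) (auto simp: antisym)
  then have "solves_dirichlet q u (\<lambda>x. - green_op u (reflect x))"
    using u(2) reflect_in_V by (auto simp: solves_dirichlet_def simp del: V.simps)
  then show ?thesis
    using solves_dirichlet_unique[OF cont _ x] by fastforce
qed

text \<open>Self-adjointness follows from the symmetry of the kernel and Fubini's theorem, which
  applies because the integrand is continuous on a compact product.\<close>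

lemma l2_inner_green_op:
  assumes "continuous_on (SG q) u" "continuous_on (SG q) v"
  shows "l2_inner \<mu> (green_op u) v = l2_inner \<mu> u (green_op v)"
proof -
  define F where "F = (\<lambda>x y. G x y * u y * v x)"
  have sym: "G x y = G y x" if "x \<in> SG q" "y \<in> SG q" for x y
    using green that by (simp add: is_green_function_def)
  have "continuous_on (SG q \<times> SG q) (\<lambda>(x, y). G x y)"
    using green by (simp add: is_green_function_def)
  then have "continuous_on (SG q \<times> SG q) (\<lambda>z. G (fst z) (snd z) * u (snd z) * v (fst z))"
    by (intro continuous_on_mult continuous_on_compose2[OF assms(1)] continuous_on_compose2[OF assms(2)]
        continuous_intros) (auto simp: case_prod_unfold)
  then have "integrable (\<mu> \<Otimes>\<^sub>M \<mu>) (case_prod F)"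
    using integrable_continuous_square by (simp add: F_def case_prod_unfold)
  then have fubini: "(LINT y|\<mu>. LINT x|\<mu>. F x y) = (LINT x|\<mu>. LINT y|\<mu>. F x y)"
    by (rule square.Fubini_integral)
  have "l2_inner \<mu> (green_op u) v = (LINT x|\<mu>. LINT y|\<mu>. F x y)"
    by (simp add: l2_inner_def F_def)
  also have "\<dots> = (LINT y|\<mu>. LINT x|\<mu>. F x y)"
    by (simp add: fubini)
  also have "\<dots> = (LINT y|\<mu>. LINT x|\<mu>. u y * (G y x * v x))"
    by (intro Bochner_Integration.integral_cong) (auto simp: F_def space_\<mu> sym)
  also have "\<dots> = l2_inner \<mu> u (green_op v)"
    by (simp add: l2_inner_def)
  finally show ?thesis .
qed

end

section \<open>Antisymmetric polynomials\<close>

locale antisymmetric_monomials = gasket_green +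
  fixes P :: "nat \<Rightarrow> plane \<Rightarrow> real"
  assumes monomials: "is_antisym_monomial q j (P j)"
begin

lemma monomial_conds: "antisym_monomial_conds q j (P j)"
  using monomials[of j] unfolding is_antisym_monomial_def by (rule conjunct1)

lemma monomial_unique: "antisym_monomial_conds q j u \<Longrightarrow> x \<in> SG q \<Longrightarrow> u x = P j x"
  using monomials[of j] unfolding is_antisym_monomial_def by blast

lemma sg_polynomial_monomial: "sg_polynomial q j (P j)"
  using monomial_conds[of j] unfolding antisym_monomial_conds_def by (rule conjunct1)

lemma monomial_antisym:
  assumes "x \<in> SG q"
  shows "P j (reflect x) = - P j x"
  using monomial_unique[OF antisym_monomial_conds_neg_reflect[OF monomial_conds[of j]] assms]
  by linarith

lemma has_laplacian_monomial_0: "has_laplacian q (P 0) (\<lambda>x. 0)"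
proof -
  obtain v where v: "has_laplacian q (P 0) v" "\<forall>x\<in>SG q. v x = 0"
    using sg_polynomial_monomial[of 0] by (auto simp: sg_polynomial_def)
  show ?thesis
    using v(2) by (intro has_laplacian_cong[OF v(1)]) auto
qed

text \<open>The conditions of order \<open>Suc m\<close> on \<open>P (Suc j)\<close> are those of
  order \<open>m\<close> on its Laplacian. Thus the Laplacian satisfies the conditions that
  characterise \<open>P j\<close>.\<close>

lemma has_laplacian_monomial_Suc: "has_laplacian q (P (Suc j)) (P j)"
proof -
  obtain u where u: "has_laplacian q (P (Suc j)) u" "has_laplacian_pow q (Suc j) u (\<lambda>x. 0)"
    using sg_polynomial_monomial[of "Suc j"] unfolding sg_polynomial_def
    by (metis has_laplacian_pow.simps(2))
  have "antisym_monomial_conds q j u"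
    unfolding antisym_monomial_conds_def
  proof (intro conjI allI impI)
    show "sg_polynomial q j u"
      unfolding sg_polynomial_def by (rule u(2))
    fix m assume "m \<le> j"
    then have "Suc m \<le> Suc j"
      by simp
    then obtain v where v: "has_laplacian_pow q (Suc m) (P (Suc j)) v" "v (q 0) = 0"
        "has_normal_deriv q v 0" "has_tangential_deriv q v (if Suc m = Suc j then 1 else 0)"
      using monomial_conds[of "Suc j"] unfolding antisym_monomial_conds_def by blast
    then obtain w where w: "has_laplacian q (P (Suc j)) w" "has_laplacian_pow q m w v"
      by auto
    have "has_laplacian_pow q m u v"
      by (intro has_laplacian_pow_cong[OF w(2)] has_laplacian_unique[OF w(1) u(1)] refl)
    then show "\<exists>v. has_laplacian_pow q m u v \<and> v (q 0) = 0 \<and> has_normal_deriv q v 0 \<and>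
        has_tangential_deriv q v (if m = j then 1 else 0)"
      using v by auto
  qed
  then show ?thesis
    by (intro has_laplacian_cong[OF u(1)] refl monomial_unique)
qed

text \<open>The tangential derivative of the \<open>j\<close>-th Laplacian of \<open>P j\<close> is
  1, whereas that of the zero function is 0.\<close>

lemma monomial_not_lower_degree: "\<not> has_laplacian_pow q j (P j) (\<lambda>x. 0)"
proof
  assume zero: "has_laplacian_pow q j (P j) (\<lambda>x. 0)"
  obtain v where v: "has_laplacian_pow q j (P j) v" "has_tangential_deriv q v 1"
    using monomial_conds[of j] unfolding antisym_monomial_conds_def by force
  have "has_tangential_deriv q (\<lambda>x. 0) 1"
    by (rule has_tangential_deriv_cong[OF v(2)]) (rule has_laplacian_pow_unique[OF v(1) zero])
  then show False
    by (simp add: has_tangential_deriv_def LIMSEQ_const_iff)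
qed

text \<open>An antisymmetric harmonic function is determined by its value at \<open>q\<^sub>1\<close>, and
  \<open>P\<^sub>0\<^sub>3\<close> does not vanish there.\<close>

lemma antisym_harmonic:
  assumes harmonic: "has_laplacian q u (\<lambda>x. 0)" and antisym: "\<And>x. x \<in> SG q \<Longrightarrow> u (reflect x) = - u x"
  obtains t where "\<And>x. x \<in> SG q \<Longrightarrow> u x = t * P 0 x"
proof -
  have boundary: "v (q 0) = 0" "v (q 2) = - v (q 1)"
    if "\<And>x. x \<in> SG q \<Longrightarrow> v (reflect x) = - v x" for v :: "plane \<Rightarrow> real"
    using that[OF vertex_in_SG[where i = 0]] that[OF vertex_in_SG[where i = 1]]
    by (simp_all add: reflect_vertex)
  have less_3: "i = 0 \<or> i = 1 \<or> i = 2" if "i < 3" for i :: nat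
    using that by auto
  note P_boundary = boundary[of "P 0", OF monomial_antisym]
  \<comment> \<open>Otherwise antisymmetry makes \<open>P 0\<close> vanish at all three vertices,
    hence on the whole gasket.\<close>
  have "P 0 (q 1) \<noteq> 0"
  proof
    assume "P 0 (q 1) = 0"
    then have "P 0 (q i) = 0" if "i < 3" for i
      using less_3[OF that] P_boundary by auto
    then have "P 0 x = 0" if "x \<in> SG q" for x
      using that by (rule harmonic_zero_boundary[OF has_laplacian_monomial_0])
    then show False
      using monomial_not_lower_degree[of 0] by simp
  qed
  define t where "t = u (q 1) / P 0 (q 1)"
  have "has_laplacian q (\<lambda>x. u x - t * P 0 x) (\<lambda>x. 0)"
    using has_laplacian_diff[OF harmonic has_laplacian_scale[OF has_laplacian_monomial_0, of t]] by simp
  moreover have "u (q i) - t * P 0 (q i) = 0" if "i < 3" for i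
    using less_3[OF that] P_boundary boundary[of u, OF antisym] \<open>P 0 (q 1) \<noteq> 0\<close> by (auto simp: t_def)
  ultimately have "u x - t * P 0 x = 0" if "x \<in> SG q" for x
    using that by (rule harmonic_zero_boundary)
  then show ?thesis
    by (intro that[of t]) simp
qed

end

text \<open>The coefficients \<open>e\<close> are left arbitrary: degree, antisymmetry, positive
  norms and the span argument depend only on the triangular monic form. Positivity is thus available
  before any division by a norm in the Gram-Schmidt process.\<close>

locale monic_polynomials = antisymmetric_monomials +
  fixes p :: "nat \<Rightarrow> plane \<Rightarrow> real" and e :: "nat \<Rightarrow> nat \<Rightarrow> real"
  assumes p_eq: "p j = (\<lambda>x. P j x - (\<Sum>l<j. e j l * p l x))"
begin

lemma sg_polynomial_p: "sg_polynomial q j (p j)"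
proof (induction j rule: less_induct)
  case (less j)
  have "has_laplacian_pow q (Suc j) (p l) (\<lambda>x. 0)" if "l < j" for l
    using less.IH[OF that] has_laplacian_pow_zero_mono[of q "Suc l" "p l" "Suc j"] that
    unfolding sg_polynomial_def by simp
  then have "has_laplacian_pow q (Suc j) (\<lambda>x. \<Sum>l<j. - e j l * p l x) (\<lambda>x. \<Sum>l<j. - e j l * 0)"
    by (intro has_laplacian_pow_sum) auto
  from has_laplacian_pow_add[OF sg_polynomial_monomial[of j, unfolded sg_polynomial_def] this]
  show ?case
    unfolding sg_polynomial_def by (subst p_eq) (simp add: sum_negf del: has_laplacian_pow.simps)
qed

lemma continuous_p: "continuous_on (SG q) (p j)"
  by (rule sg_polynomial_continuous[OF sg_polynomial_p])

lemma p_antisym: "x \<in> SG q \<Longrightarrow> p j (reflect x) = - p j x"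
proof (induction j rule: less_induct)
  case (less j)
  then show ?case
    by (simp add: p_eq[of j] monomial_antisym sum_negf)
qed

text \<open>If \<open>p j\<close> vanished, \<open>P j\<close> would be a combination of polynomials
  of lower degree and be annihilated by the \<open>j\<close>-th power of the Laplacian.\<close>

lemma p_nonzero: "\<exists>x\<in>SG q. p j x \<noteq> 0"
proof (rule ccontr)
  assume "\<not> (\<exists>x\<in>SG q. p j x \<noteq> 0)"
  then have eq: "(\<Sum>l<j. e j l * p l x) = P j x" if "x \<in> SG q" for x
    using that by (auto simp: p_eq[of j])
  have "has_laplacian_pow q j (p l) (\<lambda>x. 0)" if "l < j" for l
    using sg_polynomial_p[of l] that unfolding sg_polynomial_def
    by (elim has_laplacian_pow_zero_mono) auto
  then have "has_laplacian_pow q j (\<lambda>x. \<Sum>l<j. e j l * p l x) (\<lambda>x. \<Sum>l<j. e j l * 0)"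
    by (intro has_laplacian_pow_sum) auto
  then have "has_laplacian_pow q j (P j) (\<lambda>x. 0)"
    by (rule has_laplacian_pow_cong) (auto simp: eq)
  then show False
    using monomial_not_lower_degree by blast
qed

lemma l2_inner_p_pos: "l2_inner \<mu> (p j) (p j) > 0"
  using p_nonzero[of j] l2_inner_self_pos[OF continuous_p[of j]] by blast

section \<open>Antiderivatives and the span of the lower polynomials\<close>

abbreviation antideriv :: "nat \<Rightarrow> plane \<Rightarrow> real" where
  "antideriv k x \<equiv> - green_op (p k) x"

lemma has_laplacian_antideriv: "has_laplacian q (antideriv k) (p k)"
  by (rule has_laplacian_neg_green_op[OF continuous_p])

lemma sg_polynomial_antideriv: "sg_polynomial q (Suc k) (antideriv k)"
  unfolding sg_polynomial_def has_laplacian_pow.simps(2)[of q "Suc k"]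
  using has_laplacian_antideriv[of k] sg_polynomial_p[of k, unfolded sg_polynomial_def] by blast

lemma green_op_p_antisym: "x \<in> SG q \<Longrightarrow> green_op (p k) (reflect x) = - green_op (p k) x"
  using green_op_antisym[of "p k" x] continuous_p[of k] p_antisym[of _ k] by blast

text \<open>Equality is asked only on the gasket, since Dirichlet uniqueness gives no information
  elsewhere.\<close>

definition in_span :: "nat \<Rightarrow> (plane \<Rightarrow> real) \<Rightarrow> bool" where
  "in_span n u \<longleftrightarrow> (\<exists>a. \<forall>x\<in>SG q. u x = (\<Sum>l<n. a l * p l x))"

lemma in_span_p:
  assumes "l < n"
  shows "in_span n (p l)"
proof -
  have "(\<Sum>i<n. (if i = l then 1 else 0) * p i x) = (\<Sum>i<n. if i = l then p l x else 0)" for x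
    by (intro sum.cong) auto
  then show ?thesis
    unfolding in_span_def using assms by (intro exI[of _ "\<lambda>i. if i = l then 1 else 0"]) simp
qed

lemma in_span_add: "in_span n u \<Longrightarrow> in_span n v \<Longrightarrow> in_span n (\<lambda>x. u x + v x)"
proof -
  assume "in_span n u" "in_span n v"
  then obtain a b where "\<forall>x\<in>SG q. u x = (\<Sum>l<n. a l * p l x)" "\<forall>x\<in>SG q. v x = (\<Sum>l<n. b l * p l x)"
    unfolding in_span_def by blast
  then show ?thesis
    unfolding in_span_def
    by (intro exI[of _ "\<lambda>l. a l + b l"]) (simp add: distrib_right sum.distrib)
qed

lemma in_span_scale: "in_span n u \<Longrightarrow> in_span n (\<lambda>x. c * u x)"
proof -
  assume "in_span n u"
  then obtain a where "\<forall>x\<in>SG q. u x = (\<Sum>l<n. a l * p l x)"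
    unfolding in_span_def by blast
  then show ?thesis
    unfolding in_span_def
    by (intro exI[of _ "\<lambda>l. c * a l"]) (simp add: sum_distrib_left mult.assoc)
qed

lemma in_span_sum:
  "finite A \<Longrightarrow> (\<And>i. i \<in> A \<Longrightarrow> in_span n (u i)) \<Longrightarrow> in_span n (\<lambda>x. \<Sum>i\<in>A. c i * u i x)"
proof (induction A rule: finite_induct)
  case empty
  show ?case
    unfolding in_span_def by (intro exI[of _ "\<lambda>_. 0"]) simp
next
  case (insert i A)
  then show ?case
    using in_span_add[OF in_span_scale[of n "u i" "c i"]] by simp
qed

lemma in_span_cong: "in_span n u \<Longrightarrow> (\<And>x. x \<in> SG q \<Longrightarrow> u x = v x) \<Longrightarrow> in_span n v"
  unfolding in_span_def by simp

text \<open>With \<open>f\<^bsub>k+1\<^esub> = antideriv k\<close>, the function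
  \<open>f\<^bsub>k+1\<^esub> - P\<^bsub>k+1,3\<^esub> + (\<Sum>i<k. e k i * f\<^bsub>i+1\<^esub>)\<close> is harmonic and antisymmetric, hence a multiple
  of \<open>P\<^sub>0\<^sub>3\<close>.\<close>

lemma antideriv_minus_p_in_span: "in_span (Suc k) (\<lambda>x. antideriv k x - p (Suc k) x)"
proof (induction k rule: less_induct)
  case (less k)
  define u where "u = (\<lambda>x. antideriv k x - P (Suc k) x + (\<Sum>i<k. e k i * antideriv i x))"
  have "has_laplacian q u (\<lambda>x. p k x - P k x + (\<Sum>i<k. e k i * p i x))"
    unfolding u_def
    by (intro has_laplacian_add has_laplacian_diff has_laplacian_sum finite_lessThan
        has_laplacian_antideriv has_laplacian_monomial_Suc)
  then have "has_laplacian q u (\<lambda>x. 0)"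
    by (rule has_laplacian_cong) (auto simp: p_eq[of k])
  moreover have "u (reflect x) = - u x" if "x \<in> SG q" for x
    using green_op_p_antisym[OF that] monomial_antisym[OF that] by (simp add: u_def sum_negf)
  ultimately obtain t where t: "u x = t * P 0 x" if "x \<in> SG q" for x
    using antisym_harmonic by blast
  \<comment> \<open>By induction \<open>antideriv i\<close> is \<open>p (Suc i)\<close> plus a
    combination of \<open>p 0\<close> to \<open>p i\<close>; all these indices are at most
    \<open>k\<close>.\<close>
  have ih: "in_span (Suc k) (antideriv i)" if i: "i < k" for i
  proof -
    obtain a where a: "\<And>x. x \<in> SG q \<Longrightarrow> antideriv i x - p (Suc i) x = (\<Sum>l<Suc i. a l * p l x)"
      using less.IH[OF i] unfolding in_span_def by blast
    have "in_span (Suc k) (\<lambda>x. p (Suc i) x + (\<Sum>l<Suc i. a l * p l x))"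
      using that by (intro in_span_add in_span_p in_span_sum) auto
    then show ?thesis
      by (rule in_span_cong) (simp flip: a del: sum.lessThan_Suc)
  qed
  \<comment> \<open>Solving the definition of \<open>u\<close> for \<open>antideriv k\<close> and
    subtracting \<open>p (Suc k)\<close> cancels \<open>P (Suc k)\<close> and leaves this
    combination.\<close>
  have "in_span (Suc k) (\<lambda>x. t * p 0 x + (\<Sum>i<k. - e k i * antideriv i x)
      + (\<Sum>l<Suc k. e (Suc k) l * p l x))"
    by (intro in_span_add in_span_scale in_span_sum in_span_p ih) auto
  then show ?case
  proof (rule in_span_cong)
    fix x assume "x \<in> SG q"
    then have "antideriv k x = P (Suc k) x - (\<Sum>i<k. e k i * antideriv i x) + t * p 0 x"
      using t[of x] unfolding u_def by (simp add: p_eq[of 0])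
    moreover have "p (Suc k) x = P (Suc k) x - (\<Sum>l<Suc k. e (Suc k) l * p l x)"
      by (simp only: p_eq[of "Suc k"])
    moreover have "(\<Sum>i<k. - e k i * antideriv i x) = - (\<Sum>i<k. e k i * antideriv i x)"
      by (simp flip: sum_negf)
    ultimately show "t * p 0 x + (\<Sum>i<k. - e k i * antideriv i x) + (\<Sum>l<Suc k. e (Suc k) l * p l x) =
        antideriv k x - p (Suc k) x"
      by linarith
  qed
qed

lemma antideriv_expansion:
  obtains a where "\<And>x. x \<in> SG q \<Longrightarrow> antideriv k x = p (Suc k) x + (\<Sum>l<Suc k. a l * p l x)"
proof -
  obtain a where "\<And>x. x \<in> SG q \<Longrightarrow> antideriv k x - p (Suc k) x = (\<Sum>l<Suc k. a l * p l x)"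
    using antideriv_minus_p_in_span[of k] unfolding in_span_def by blast
  then show ?thesis
    using that[of a] by (simp only: diff_eq_eq add.commute)
qed

section \<open>Orthogonality and the recurrence\<close>

lemma l2_inner_antideriv: "l2_inner \<mu> (antideriv k) (p l) = l2_inner \<mu> (p k) (antideriv l)"
  using l2_inner_green_op[OF continuous_p[of k] continuous_p[of l]]
  by (simp add: l2_inner_def)

text \<open>All coefficients of the expansion of \<open>antideriv k\<close> are inner products.
  Self-adjointness turns the one at \<open>p l\<close> into an inner product of \<open>p k\<close>
  with \<open>antideriv l\<close>, whose degree is too small unless \<open>l\<close> is
  \<open>k\<close> or \<open>k - 1\<close>.\<close>

lemma three_term_recurrence:
  assumes orth: "\<And>i j. i \<noteq> j \<Longrightarrow> l2_inner \<mu> (p i) (p j) = 0" and x: "x \<in> SG q"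
  defines "n \<equiv> \<lambda>k. l2_inner \<mu> (p k) (p k)"
  shows "p (Suc k) x = antideriv k x - l2_inner \<mu> (antideriv k) (p k) / n k * p k x
    - (case k of 0 \<Rightarrow> 0 | Suc j \<Rightarrow> n k / n j * p j x)"
proof -
  have n: "n k \<noteq> 0" for k
    using l2_inner_p_pos[of k] by (simp add: n_def)
  \<comment> \<open>Stated for every index because it serves twice: for \<open>antideriv k\<close>
    itself and, in \<open>top\<close>, for the antiderivatives of lower index.\<close>
  have expand: "l2_inner \<mu> (antideriv k) (p l) = l2_inner \<mu> (p (Suc k)) (p l) + (if l < Suc k then a l * n l else 0)"
    if a: "\<And>x. x \<in> SG q \<Longrightarrow> antideriv k x = p (Suc k) x + (\<Sum>l<Suc k. a l * p l x)" for a k l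
  proof -
    have "l2_inner \<mu> (antideriv k) (p l) = l2_inner \<mu> (\<lambda>x. p (Suc k) x + (\<Sum>l<Suc k. a l * p l x)) (p l)"
      using a by (intro l2_inner_cong) auto
    also have "\<dots> = l2_inner \<mu> (p (Suc k)) (p l) + l2_inner \<mu> (\<lambda>x. \<Sum>l<Suc k. a l * p l x) (p l)"
      by (intro l2_inner_add_left continuous_intros continuous_p)
    also have "l2_inner \<mu> (\<lambda>x. \<Sum>l<Suc k. a l * p l x) (p l) = (\<Sum>i<Suc k. a i * l2_inner \<mu> (p i) (p l))"
      by (intro l2_inner_sum_left continuous_p)
    also have "\<dots> = (\<Sum>i<Suc k. if i = l then a l * n l else 0)"
      by (intro sum.cong) (auto simp: orth n_def)
    also have "\<dots> = (if l < Suc k then a l * n l else 0)"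
      by (subst sum.delta) auto
    finally show ?thesis .
  qed
  \<comment> \<open>Only the leading term \<open>p (Suc l)\<close>, which has coefficient 1, can
    meet \<open>p k\<close>.\<close>
  have top: "l2_inner \<mu> (antideriv l) (p k) = (if k = Suc l then n k else 0)" if "l < k" for l k
  proof -
    obtain a where "\<And>x. x \<in> SG q \<Longrightarrow> antideriv l x = p (Suc l) x + (\<Sum>i<Suc l. a i * p i x)"
      using antideriv_expansion by blast
    from expand[OF this, of k] show ?thesis
      using that by (auto simp: orth n_def)
  qed
  obtain a where a: "\<And>x. x \<in> SG q \<Longrightarrow> antideriv k x = p (Suc k) x + (\<Sum>l<Suc k. a l * p l x)"
    using antideriv_expansion by blast
  have coeff: "a l = l2_inner \<mu> (antideriv k) (p l) / n l" if "l < Suc k" for l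
    using expand[OF a, of l] that n[of l] orth[of "Suc k" l] by simp
  have sub: "a l = (if k = Suc l then n k / n l else 0)" if "l < k" for l
    using coeff[of l] top[OF that] that by (simp add: l2_inner_antideriv l2_inner_commute[of "p k"])
  \<comment> \<open>Below index \<open>k\<close> only the term with index \<open>k - 1\<close>
    survives; for \<open>k = 0\<close> the sum is empty.\<close>
  have "(\<Sum>l<k. a l * p l x) = (case k of 0 \<Rightarrow> 0 | Suc j \<Rightarrow> n k / n j * p j x)"
  proof (cases k)
    case (Suc j)
    then have "a l = 0" if "l < j" for l
      using sub[of l] that by simp
    then show ?thesis
      using sub[of j] Suc by simp
  qed simp
  then show ?thesis
    using a[OF x] coeff[of k] by simp
qed

text \<open>Strong induction on the larger index: in the product of \<open>p j\<close> with
  \<open>p l\<close> only the \<open>l\<close>-th subtracted term remains, and it cancels the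
  product of \<open>P j\<close> with \<open>p l\<close>.\<close>

lemma gram_schmidt_orthogonal:
  assumes e: "\<And>j l. l < j \<Longrightarrow> e j l = l2_inner \<mu> (P j) (p l) / l2_inner \<mu> (p l) (p l)" and "i \<noteq> j"
  shows "l2_inner \<mu> (p i) (p j) = 0"
proof -
  have "l < j \<Longrightarrow> l2_inner \<mu> (p j) (p l) = 0" for j l
  proof (induction j arbitrary: l rule: less_induct)
    case (less j)
    \<comment> \<open>Both indices lie below \<open>j\<close>, so the induction hypothesis is
      applied to the larger of them.\<close>
    have zero: "l2_inner \<mu> (p i) (p l) = 0" if "i < j" "i \<noteq> l" for i
      using less.IH[of i l] less.IH[of l i] less.prems that
      by (cases "i < l") (auto simp: l2_inner_commute)
    have "l2_inner \<mu> (p j) (p l) = l2_inner \<mu> (\<lambda>x. P j x + (\<Sum>i<j. - e j i * p i x)) (p l)"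
      by (subst p_eq) (simp add: sum_negf)
    also have "\<dots> = l2_inner \<mu> (P j) (p l) + l2_inner \<mu> (\<lambda>x. \<Sum>i<j. - e j i * p i x) (p l)"
      by (intro l2_inner_add_left continuous_intros continuous_p
          sg_polynomial_continuous[OF sg_polynomial_monomial])
    also have "l2_inner \<mu> (\<lambda>x. \<Sum>i<j. - e j i * p i x) (p l) = (\<Sum>i<j. - e j i * l2_inner \<mu> (p i) (p l))"
      by (intro l2_inner_sum_left continuous_p)
    also have "\<dots> = (\<Sum>i<j. if i = l then - e j l * l2_inner \<mu> (p l) (p l) else 0)"
      by (intro sum.cong) (auto simp: zero)
    also have "\<dots> = - l2_inner \<mu> (P j) (p l)"
      using less.prems l2_inner_p_pos[of l] by (simp add: e)
    finally show ?case
      by simp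
  qed
  then show ?thesis
    using \<open>i \<noteq> j\<close> l2_inner_commute by (metis linorder_neqE_nat)
qed

end

theorem theorem3p2:
  fixes q :: "nat \<Rightarrow> plane" and \<mu> :: "plane measure"
    and G :: "plane \<Rightarrow> plane \<Rightarrow> real"
    and P p p_prev f :: "nat \<Rightarrow> plane \<Rightarrow> real"
    and b c d :: "nat \<Rightarrow> real"
  assumes triangle: "equilateral q"
    and measure: "sg_measure q \<mu>"
    and green: "is_green_function q \<mu> G"
    and monomials: "\<And>j. is_antisym_monomial q j (P j)"
    and p_0: "p 0 = P 0"
    and p_gram_schmidt:
      "\<And>j. j \<ge> 1 \<Longrightarrow> p j = (\<lambda>x. P j x - (\<Sum>l<j. (d l)\<^sup>2 * l2_inner \<mu> (P j) (p l) * p l x))"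
    and p_prev_0: "p_prev 0 = (\<lambda>x. 0)"
    and p_prev_Suc: "\<And>k. p_prev (Suc k) = p k"
    and d: "\<And>k. d k = inverse (l2_norm \<mu> (p k))"
    and f_0: "f 0 = (\<lambda>x. 0)"
    and f_Suc: "\<And>k. f (Suc k) = (\<lambda>x. - (LINT y|\<mu>. G x y * p k y))"
    and b: "\<And>k. b k = (d k)\<^sup>2 * l2_inner \<mu> (f (Suc k)) (p k)"
    and c: "\<And>k. k \<ge> 1 \<Longrightarrow> c k = (d (k - 1))\<^sup>2 / (d k)\<^sup>2"
  shows "(\<forall>k. d k > 0) \<and>
    (\<forall>k. \<exists>n. sg_polynomial q n (f (Suc k))) \<and>
    (\<forall>k. \<forall>x\<in>SG q. p (Suc k) x = f (Suc k) x - b k * p k x - c k * p_prev k x) \<and>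
    (\<forall>k\<ge>1. c k = (l2_norm \<mu> (p k))\<^sup>2 / (l2_norm \<mu> (p (k - 1)))\<^sup>2) \<and>
    (\<forall>k\<ge>1. inverse ((d k)\<^sup>2) = (l2_norm \<mu> (p k))\<^sup>2 \<and>
       (l2_norm \<mu> (p k))\<^sup>2 = inverse ((d 0)\<^sup>2) * (\<Prod>i=1..k. c i))"
proof -
  define e where "e = (\<lambda>j l. (d l)\<^sup>2 * l2_inner \<mu> (P j) (p l))"
  define n where "n = (\<lambda>k. l2_inner \<mu> (p k) (p k))"
  \<comment> \<open>For \<open>j = 0\<close> the sum is empty, so the initial value fits the general
    formula.\<close>
  have p_eq: "p j = (\<lambda>x. P j x - (\<Sum>l<j. e j l * p l x))" for j
    using p_0 p_gram_schmidt[of j] by (cases "j = 0") (auto simp: e_def)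
  interpret monic_polynomials q \<mu> G P p e
    by unfold_locales (fact triangle measure green monomials p_eq)+
  have n_pos: "n k > 0" for k
    using l2_inner_p_pos by (simp add: n_def)
  have inner_p: "l2_inner \<mu> (p k) (p k) = n k" for k
    by (simp add: n_def)
  have norm: "(l2_norm \<mu> (p k))\<^sup>2 = n k" and norm_pos: "l2_norm \<mu> (p k) > 0" for k
    using n_pos[of k] by (simp_all add: l2_norm_def n_def)
  have d2: "(d k)\<^sup>2 = inverse (n k)" for k
    by (simp add: d power_inverse norm)
  have c_eq: "c (Suc k) = n (Suc k) / n k" for k
    by (simp add: c d2 divide_inverse mult.commute)
  have f_eq: "f (Suc k) = antideriv k" for k
    by (simp add: f_Suc)
  have orth: "l2_inner \<mu> (p i) (p j) = 0" if "i \<noteq> j" for i j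
    by (rule gram_schmidt_orthogonal[OF _ that]) (simp add: e_def d2 inner_p divide_inverse mult.commute)
  \<comment> \<open>At \<open>k = 0\<close> the value of \<open>c 0\<close> is unspecified, but it
    multiplies the zero function \<open>p_prev 0\<close>.\<close>
  have recurrence: "p (Suc k) x = f (Suc k) x - b k * p k x - c k * p_prev k x" if "x \<in> SG q" for k x
    using three_term_recurrence[OF orth that, of k]
    by (cases k) (simp_all add: b d2 f_eq c_eq p_prev_0 p_prev_Suc divide_inverse mult.commute inner_p)
  have telescope: "n k = n 0 * (\<Prod>i=1..k. c i)" for k
  proof (induction k)
    case (Suc k)
    have "n (Suc k) = n k * c (Suc k)"
      using n_pos[of k] by (simp add: c_eq)
    then show ?case
      using Suc by simp
  qed simp
  show ?thesis
  proof (intro conjI allI ballI impI)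
    show "d k > 0" for k
      using norm_pos by (simp add: d)
    show "\<exists>n. sg_polynomial q n (f (Suc k))" for k
      unfolding f_eq using sg_polynomial_antideriv by blast
    show "p (Suc k) x = f (Suc k) x - b k * p k x - c k * p_prev k x" if "x \<in> SG q" for k x
      by (rule recurrence[OF that])
    show "c k = (l2_norm \<mu> (p k))\<^sup>2 / (l2_norm \<mu> (p (k - 1)))\<^sup>2" if "k \<ge> 1" for k
      using that c_eq[of "k - 1"] by (simp add: norm)
    show "inverse ((d k)\<^sup>2) = (l2_norm \<mu> (p k))\<^sup>2" for k
      by (simp add: d2 norm)
    show "(l2_norm \<mu> (p k))\<^sup>2 = inverse ((d 0)\<^sup>2) * (\<Prod>i=1..k. c i)" for k
      by (simp only: d2 norm inverse_inverse_eq telescope[symmetric])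
  qed
qed

end
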